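(* Let $G_1,\ldots,G_k$ be finite simple connected graphs, $G_i$ having $n_i$ vertices and $m_i$ edges, and let $n=n_1n_2\cdots n_k$ be the number of vertices of the Cartesian product $G_1\otimes G_2\otimes\cdots\otimes G_k$. Then \[F(G_1\otimes\cdots\otimes G_k)=n\sum_{i=1}^k\frac{F(G_i)}{n_i}+6n\sum_{\substack{i,j=1\\ i\neq j}}^k\frac{M_1(G_i)}{n_i}\cdot\frac{m_j}{n_j}+8n\sum_{\substack{p,q,r=1\\ p,q,r\text{ pairwise distinct}}}^k\frac{m_p}{n_p}\cdot\frac{m_q}{n_q}\cdot\frac{m_r}{n_r},\] where the second sum runs over ordered pairs $(i,j)$ with $i\neq j$ and the third over ordered triples $(p,q,r)$ of pairwise distinct indices.
   Context: The Cartesian product $G_1\otimes G_2$ has vertex set $V(G_1)\times V(G_2)$, with $(u_p,v_r)$ adjacent to $(u_q,v_s)$ iff [$u_p=u_q$ and $v_rv_s\in E(G_2)$] or [$v_r=v_s$ and $u_pu_q\in E(G_1)$]; the $k$-fold product $G_1\otimes\cdots\otimes G_k$ is obtained by iterating this operation (equivalently, vertices are $k$-tuples, two being adjacent iff they differ in exactly one coordinate $i$ and the two $i$-th coordinates are adjacent in $G_i$). For a finite simple graph $G$ with vertex degrees $d_G(v)$: $M_1(G)=\sum_{v} d_G(v)^2$ and $F(G)=\sum_{v} d_G(v)^3$. *)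

theory Defs
  imports Complex_Main "HOL-Library.FuncSet" "Graph_Theory.Graph_Theory"
begin

text \<open>
  A finite simple graph is a \<^locale>\<open>pair_graph\<close>: a finite loop-free digraph without parallel
  arcs whose arc relation is symmetric. An undirected edge \<open>uv\<close> is thus represented by the two
  arcs \<open>(u, v)\<close> and \<open>(v, u)\<close>, and the degree of \<open>v\<close> is its \<^const>\<open>out_degree\<close>.
\<close>

definition uedges :: "'a pair_pre_digraph \<Rightarrow> 'a set set" where
  "uedges G = {{u, v} |u v. (u, v) \<in> parcs G}"

definition first_zagreb :: "'a pair_pre_digraph \<Rightarrow> nat" where
  "first_zagreb G = (\<Sum>v\<in>pverts G. out_degree (with_proj G) v ^ 2)"

definition forgotten_index :: "'a pair_pre_digraph \<Rightarrow> nat" where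
  "forgotten_index G = (\<Sum>v\<in>pverts G. out_degree (with_proj G) v ^ 3)"

definition cartesian_product ::
  "'a pair_pre_digraph \<Rightarrow> 'b pair_pre_digraph \<Rightarrow> ('a \<times> 'b) pair_pre_digraph" where
  "cartesian_product G H = \<lparr>
     pverts = pverts G \<times> pverts H,
     parcs = {(x, y). x \<in> pverts G \<times> pverts H \<and> y \<in> pverts G \<times> pverts H \<and>
       (fst x = fst y \<and> (snd x, snd y) \<in> parcs H \<or>
        snd x = snd y \<and> (fst x, fst y) \<in> parcs G)} \<rparr>"

text \<open>
  The product of a family, whose vertices are tuples encoded as extensional functions on the
  index set. The lemmas \<open>cartesian_product_family_singleton\<close> and
  \<open>cartesian_product_family_Suc\<close> below show that on \<open>{1..k}\<close> it is, up to isomorphism, the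
  iterated binary product.
\<close>

definition cartesian_product_family ::
  "'i set \<Rightarrow> ('i \<Rightarrow> 'a pair_pre_digraph) \<Rightarrow> ('i \<Rightarrow> 'a) pair_pre_digraph" where
  "cartesian_product_family I G = \<lparr>
     pverts = (\<Pi>\<^sub>E i\<in>I. pverts (G i)),
     parcs = {(x, y). x \<in> (\<Pi>\<^sub>E i\<in>I. pverts (G i)) \<and> y \<in> (\<Pi>\<^sub>E i\<in>I. pverts (G i)) \<and>
       (\<exists>i\<in>I. {j \<in> I. x j \<noteq> y j} = {i} \<and> (x i, y i) \<in> parcs (G i))} \<rparr>"

lemma card_pverts_cartesian_product_family:
  "finite I \<Longrightarrow>
    card (pverts (cartesian_product_family I G)) = (\<Prod>i\<in>I. card (pverts (G i)))"
  by (simp add: cartesian_product_family_def card_PiE)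

lemma pair_graph_cartesian_product_family:
  assumes "finite I" and "\<And>i. i \<in> I \<Longrightarrow> pair_graph (G i)"
  shows "pair_graph (cartesian_product_family I G)"
proof -
  let ?P = "cartesian_product_family I G"
  have fin: "finite (pverts ?P)"
    using assms by (auto simp: cartesian_product_family_def intro!: finite_PiE
      pair_fin_digraph.pair_finite_verts dest: pair_graph.axioms pair_digraph.axioms)
  have sub: "parcs ?P \<subseteq> pverts ?P \<times> pverts ?P"
    by (auto simp: cartesian_product_family_def)
  have symG: "(b, a) \<in> parcs (G i)" if "i \<in> I" "(a, b) \<in> parcs (G i)" for i a b
  proof -
    interpret pair_graph "G i" using assms(2) that(1) .
    from pair_sym_arcs that(2) show ?thesis by (auto simp: symmetric_def dest: symD)
  qed
  have "sym (parcs ?P)"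
  proof (rule symI)
    fix x y assume "(x, y) \<in> parcs ?P"
    moreover have "{j \<in> I. x j \<noteq> y j} = {j \<in> I. y j \<noteq> x j}" by auto
    ultimately show "(y, x) \<in> parcs ?P"
      using symG by (auto simp: cartesian_product_family_def)
  qed
  moreover have "x \<noteq> y" if "(x, y) \<in> parcs ?P" for x y
    using that by (auto simp: cartesian_product_family_def)
  ultimately show ?thesis
    using fin sub finite_subset[OF sub]
    by unfold_locales (auto simp: symmetric_def)
qed

lemma cartesian_product_family_singleton:
  assumes "pair_graph (G i)"
  shows "digraph_iso (with_proj (cartesian_product_family {i} G)) (with_proj (G i))"
proof -
  interpret pair_graph "G i" by fact
  let ?P = "cartesian_product_family {i} G"
  let ?f = "\<lambda>x. x i"
  let ?h = "\<lparr>iso_verts = ?f, iso_arcs = map_prod ?f ?f, iso_head = snd, iso_tail = fst\<rparr>"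
  interpret P: pair_graph ?P
    using assms by (intro pair_graph_cartesian_product_family) auto
  have inj: "inj_on ?f (pverts ?P)"
    by (auto simp: cartesian_product_family_def intro!: inj_onI intro: PiE_ext)
  have "inj_on (map_prod ?f ?f) (parcs ?P)"
    by (rule inj_on_subset[OF map_prod_inj_on[OF inj inj]])
      (auto simp: cartesian_product_family_def)
  then have hom: "pre_digraph.digraph_isomorphism (with_proj ?P) ?h"
    using inj P.wf_digraph by (simp add: pre_digraph.digraph_isomorphism_def)
  have V: "?f ` pverts ?P = pverts (G i)"
  proof (intro equalityI subsetI)
    fix v assume "v \<in> pverts (G i)"
    then show "v \<in> ?f ` pverts ?P"
      by (intro image_eqI[of _ _ "\<lambda>j\<in>{i}. v"])
        (auto simp: cartesian_product_family_def)
  qed (auto simp: cartesian_product_family_def)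
  have A: "map_prod ?f ?f ` parcs ?P = parcs (G i)"
  proof (intro equalityI subsetI)
    fix e assume "e \<in> parcs (G i)"
    moreover obtain u v where "e = (u, v)" by (cases e)
    ultimately show "e \<in> map_prod ?f ?f ` parcs ?P"
      using in_arcsD1 in_arcsD2 no_loops'
      by (intro image_eqI[of _ _ "(\<lambda>j\<in>{i}. u, \<lambda>j\<in>{i}. v)"])
        (auto simp: cartesian_product_family_def)
  qed (auto simp: cartesian_product_family_def)
  have "with_proj (G i) = app_iso ?h (with_proj ?P)"
    using V A by (simp add: app_iso_def with_proj_def)
  with hom show ?thesis unfolding digraph_iso_def by blast
qed

lemma cartesian_product_family_Suc:
  fixes k :: nat
  assumes "\<And>i. i \<in> {1..Suc k} \<Longrightarrow> pair_graph (G i)"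
  shows "digraph_iso (with_proj (cartesian_product_family {1..Suc k} G))
    (with_proj (cartesian_product (cartesian_product_family {1..k} G) (G (Suc k))))"
proof -
  let ?P = "cartesian_product_family {1..Suc k} G"
  let ?Q = "cartesian_product (cartesian_product_family {1..k} G) (G (Suc k))"
  let ?f = "\<lambda>x. (restrict x {1..k}, x (Suc k))"
  let ?h = "\<lparr>iso_verts = ?f, iso_arcs = map_prod ?f ?f, iso_head = snd, iso_tail = fst\<rparr>"
  let ?g = "\<lambda>p. (fst p)(Suc k := snd p)"
  interpret P: pair_graph ?P
    using assms by (intro pair_graph_cartesian_product_family) auto
  interpret P': pair_graph "cartesian_product_family {1..k} G"
    using assms by (intro pair_graph_cartesian_product_family) auto
  interpret L: pair_graph "G (Suc k)" using assms by auto
  have I: "{1..Suc k} = insert (Suc k) {1..k}" by auto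
  have fV: "?f x \<in> pverts ?Q" if "x \<in> pverts ?P" for x
    using that by (auto simp: cartesian_product_family_def cartesian_product_def PiE_def)
  have gV: "?g p \<in> pverts ?P" if "p \<in> pverts ?Q" for p
    using that unfolding I
    by (auto simp: cartesian_product_family_def cartesian_product_def PiE_def extensional_def)
  have fg: "?f (?g p) = p" if "p \<in> pverts ?Q" for p
    using that
    by (cases p) (auto simp: cartesian_product_family_def cartesian_product_def PiE_def
        extensional_def restrict_def fun_eq_iff)
  have gf: "?g (?f x) = x" if "x \<in> pverts ?P" for x
    using that
    by (auto simp: cartesian_product_family_def PiE_def extensional_def restrict_def fun_eq_iff
        le_Suc_eq)
  have inj: "inj_on ?f (pverts ?P)"
    by (rule inj_on_inverseI[of _ ?g]) (rule gf)
  have adj: "(x, y) \<in> parcs ?P \<longleftrightarrow> (?f x, ?f y) \<in> parcs ?Q"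
    if x: "x \<in> pverts ?P" and y: "y \<in> pverts ?P" for x y
  proof -
    have r: "restrict x {1..k} \<in> (\<Pi>\<^sub>E i\<in>{1..k}. pverts (G i))"
      "restrict y {1..k} \<in> (\<Pi>\<^sub>E i\<in>{1..k}. pverts (G i))"
      "x (Suc k) \<in> pverts (G (Suc k))" "y (Suc k) \<in> pverts (G (Suc k))"
      using fV[OF x] fV[OF y]
      by (simp_all add: cartesian_product_family_def cartesian_product_def)
    have eq: "restrict x {1..k} = restrict y {1..k} \<longleftrightarrow> {j \<in> {1..k}. x j \<noteq> y j} = {}"
      by (auto simp: restrict_def fun_eq_iff)
    have D: "{j \<in> {1..Suc k}. x j \<noteq> y j} =
      {j \<in> {1..k}. x j \<noteq> y j} \<union> (if x (Suc k) = y (Suc k) then {} else {Suc k})"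
      unfolding I by auto
    have D': "{j \<in> {1..k}. restrict x {1..k} j \<noteq> restrict y {1..k} j} = {j \<in> {1..k}. x j \<noteq> y j}"
      by auto
    have nS: "Suc k \<notin> {j \<in> {1..k}. x j \<noteq> y j}" by simp
    have "(x, y) \<in> parcs ?P \<longleftrightarrow>
      (\<exists>i\<in>{1..Suc k}. {j \<in> {1..Suc k}. x j \<noteq> y j} = {i} \<and> (x i, y i) \<in> parcs (G i))"
      using x y by (simp add: cartesian_product_family_def)
    also have "\<dots> \<longleftrightarrow>
      {j \<in> {1..Suc k}. x j \<noteq> y j} = {Suc k} \<and> (x (Suc k), y (Suc k)) \<in> parcs (G (Suc k)) \<or>
      (\<exists>i\<in>{1..k}. {j \<in> {1..Suc k}. x j \<noteq> y j} = {i} \<and> (x i, y i) \<in> parcs (G i))"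
      unfolding I by blast
    also have "{j \<in> {1..Suc k}. x j \<noteq> y j} = {Suc k} \<and> (x (Suc k), y (Suc k)) \<in> parcs (G (Suc k))
      \<longleftrightarrow> {j \<in> {1..k}. x j \<noteq> y j} = {} \<and> (x (Suc k), y (Suc k)) \<in> parcs (G (Suc k))"
    proof -
      have "(if P then {} else {a}) \<union> A = {a} \<and> R \<longleftrightarrow> A = {} \<and> R"
        if "a \<notin> A" and "R \<Longrightarrow> \<not> P" for A and a :: nat and P R
        using that by (cases P) auto
      from this[OF nS L.no_loops'] show ?thesis unfolding D by (simp only: Un_commute)
    qed
    also have "(\<exists>i\<in>{1..k}. {j \<in> {1..Suc k}. x j \<noteq> y j} = {i} \<and> (x i, y i) \<in> parcs (G i))
      \<longleftrightarrow> x (Suc k) = y (Suc k) \<and>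
        (\<exists>i\<in>{1..k}. {j \<in> {1..k}. x j \<noteq> y j} = {i} \<and> (x i, y i) \<in> parcs (G i))"
    proof (cases "x (Suc k) = y (Suc k)")
      case False
      then have "Suc k \<in> {j \<in> {1..Suc k}. x j \<noteq> y j}" by simp
      then have "{j \<in> {1..Suc k}. x j \<noteq> y j} \<noteq> {i}" if "i \<in> {1..k}" for i
        using that by (metis atLeastAtMost_iff not_less_eq_eq order_refl singletonD)
      with False show ?thesis by blast
    qed (simp only: D if_True Un_empty_right simp_thms)
    also have "({j \<in> {1..k}. x j \<noteq> y j} = {} \<and> (x (Suc k), y (Suc k)) \<in> parcs (G (Suc k)) \<or>
      x (Suc k) = y (Suc k) \<and>
        (\<exists>i\<in>{1..k}. {j \<in> {1..k}. x j \<noteq> y j} = {i} \<and> (x i, y i) \<in> parcs (G i)))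
      \<longleftrightarrow> (?f x, ?f y) \<in> parcs ?Q"
    proof -
      have Q: "(?f x, ?f y) \<in> parcs ?Q \<longleftrightarrow>
        restrict x {1..k} = restrict y {1..k} \<and> (x (Suc k), y (Suc k)) \<in> parcs (G (Suc k)) \<or>
        x (Suc k) = y (Suc k) \<and>
          (restrict x {1..k}, restrict y {1..k}) \<in> parcs (cartesian_product_family {1..k} G)"
        using fV[OF x] fV[OF y] by (simp add: cartesian_product_def)
      have "(restrict x {1..k}, restrict y {1..k}) \<in> parcs (cartesian_product_family {1..k} G) \<longleftrightarrow>
        (\<exists>i\<in>{1..k}. {j \<in> {1..k}. restrict x {1..k} j \<noteq> restrict y {1..k} j} = {i} \<and>
          (restrict x {1..k} i, restrict y {1..k} i) \<in> parcs (G i))"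
        using r(1,2) unfolding cartesian_product_family_def pair_pre_digraph.simps by blast
      also have "\<dots> \<longleftrightarrow>
        (\<exists>i\<in>{1..k}. {j \<in> {1..k}. x j \<noteq> y j} = {i} \<and> (x i, y i) \<in> parcs (G i))"
        unfolding D' by (rule bex_cong) simp_all
      finally show ?thesis by (simp only: Q eq)
    qed
    finally show ?thesis .
  qed
  have subQ: "parcs ?Q \<subseteq> pverts ?Q \<times> pverts ?Q"
    by (auto simp: cartesian_product_def)
  have "inj_on (map_prod ?f ?f) (parcs ?P)"
    by (rule inj_on_subset[OF map_prod_inj_on[OF inj inj]])
      (auto simp: cartesian_product_family_def)
  then have hom: "pre_digraph.digraph_isomorphism (with_proj ?P) ?h"
    using inj P.wf_digraph by (simp add: pre_digraph.digraph_isomorphism_def)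
  have V: "?f ` pverts ?P = pverts ?Q"
  proof (intro equalityI subsetI)
    fix p assume "p \<in> pverts ?Q"
    then show "p \<in> ?f ` pverts ?P"
      using fg gV by (intro image_eqI[of _ _ "?g p"]) (simp_all only:)
  qed (use fV in blast)
  have A: "map_prod ?f ?f ` parcs ?P = parcs ?Q"
  proof (intro equalityI subsetI)
    fix e assume "e \<in> map_prod ?f ?f ` parcs ?P"
    then obtain x y where "(x, y) \<in> parcs ?P" "e = (?f x, ?f y)" by auto
    then show "e \<in> parcs ?Q" using adj P.in_arcsD1 P.in_arcsD2 by blast
  next
    fix e assume e: "e \<in> parcs ?Q"
    obtain p q where pq: "e = (p, q)" by (cases e)
    with e subQ have p: "p \<in> pverts ?Q" and q: "q \<in> pverts ?Q" by auto
    have "(?g p, ?g q) \<in> parcs ?P"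
      using adj[OF gV[OF p] gV[OF q]] e unfolding fg[OF p] fg[OF q] pq by blast
    then have "map_prod ?f ?f (?g p, ?g q) \<in> map_prod ?f ?f ` parcs ?P" by (rule imageI)
    then show "e \<in> map_prod ?f ?f ` parcs ?P"
      unfolding map_prod_simp fg[OF p] fg[OF q] pq .
  qed
  have "with_proj ?Q = app_iso ?h (with_proj ?P)"
    using V A by (simp add: app_iso_def with_proj_def)
  with hom show ?thesis unfolding digraph_iso_def by blast
qed

end

theory Submission
  imports Defs
begin

text \<open>
  The degree of a tuple in the product is the sum of the degrees of its coordinates, so its cube
  splits into monomials in the degrees of one, two or three distinct coordinates. Summed over all
  tuples, a product of functions of distinct coordinates factorises, each coordinate contributing
  its average: by the handshake lemma, these averages are \<open>F(G\<^sub>i) / n\<^sub>i\<close>, \<open>M\<^sub>1(G\<^sub>i) / n\<^sub>i\<close> and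
  \<open>2 m\<^sub>i / n\<^sub>i\<close>.
\<close>

lemma sum_distinct_pairs:
  fixes f :: "'i \<Rightarrow> 'i \<Rightarrow> 'b :: comm_monoid_add"
  assumes "finite I"
  shows "(\<Sum>(i, j) \<in> {(i, j). i \<in> I \<and> j \<in> I \<and> i \<noteq> j}. f i j) =
    (\<Sum>i\<in>I. \<Sum>j\<in>I. if i \<noteq> j then f i j else 0)"
proof -
  have "{(i, j). i \<in> I \<and> j \<in> I \<and> i \<noteq> j} = {x \<in> I \<times> I. case x of (i, j) \<Rightarrow> i \<noteq> j}"
    by auto
  then show ?thesis
    using assms by (simp add: sum.inter_filter sum.cartesian_product case_prod_unfold)
qed

lemma sum_distinct_triples:
  fixes f :: "'i \<Rightarrow> 'i \<Rightarrow> 'i \<Rightarrow> 'b :: comm_monoid_add"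
  assumes "finite I"
  shows "(\<Sum>(p, q, r) \<in> {(p, q, r). p \<in> I \<and> q \<in> I \<and> r \<in> I \<and> p \<noteq> q \<and> p \<noteq> r \<and> q \<noteq> r}. f p q r) =
    (\<Sum>p\<in>I. \<Sum>q\<in>I. \<Sum>r\<in>I. if p \<noteq> q \<and> p \<noteq> r \<and> q \<noteq> r then f p q r else 0)"
proof -
  have "{(p, q, r). p \<in> I \<and> q \<in> I \<and> r \<in> I \<and> p \<noteq> q \<and> p \<noteq> r \<and> q \<noteq> r} =
    {x \<in> I \<times> I \<times> I. case x of (p, q, r) \<Rightarrow> p \<noteq> q \<and> p \<noteq> r \<and> q \<noteq> r}"
    by auto
  then show ?thesis
    using assms by (simp add: sum.inter_filter sum.cartesian_product case_prod_unfold)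
qed

lemma sum_power3_distinct:
  fixes a :: "'i \<Rightarrow> 'b :: comm_ring_1"
  assumes "finite I"
  shows "(\<Sum>i\<in>I. a i) ^ 3 = (\<Sum>i\<in>I. a i ^ 3)
    + 3 * (\<Sum>(i, j) \<in> {(i, j). i \<in> I \<and> j \<in> I \<and> i \<noteq> j}. a i ^ 2 * a j)
    + (\<Sum>(p, q, r) \<in> {(p, q, r). p \<in> I \<and> q \<in> I \<and> r \<in> I \<and> p \<noteq> q \<and> p \<noteq> r \<and> q \<noteq> r}.
        a p * a q * a r)"
proof -
  let ?s = "\<Sum>i\<in>I. a i"
  have pairs: "(\<Sum>(i, j) \<in> {(i, j). i \<in> I \<and> j \<in> I \<and> i \<noteq> j}. a i ^ 2 * a j) =
    (\<Sum>i\<in>I. a i ^ 2) * ?s - (\<Sum>i\<in>I. a i ^ 3)"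
  proof -
    have "(\<Sum>j\<in>I. if i \<noteq> j then a i ^ 2 * a j else 0) = a i ^ 2 * ?s - a i ^ 3"
      if "i \<in> I" for i
    proof -
      have "(\<Sum>j\<in>I. if i \<noteq> j then a i ^ 2 * a j else 0) =
        (\<Sum>j\<in>I. a i ^ 2 * a j - (if i = j then a i ^ 2 * a j else 0))"
        by (intro sum.cong) auto
      also have "\<dots> = a i ^ 2 * ?s - a i ^ 3"
        using assms that
        by (simp add: sum_subtractf sum_distrib_left power2_eq_square power3_eq_cube)
      finally show ?thesis .
    qed
    then show ?thesis
      using assms by (simp add: sum_distinct_pairs sum_subtractf sum_distrib_right)
  qed
  have triples: "(\<Sum>(p, q, r) \<in> {(p, q, r). p \<in> I \<and> q \<in> I \<and> r \<in> I \<and> p \<noteq> q \<and> p \<noteq> r \<and> q \<noteq> r}.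
      a p * a q * a r) = ?s ^ 3 - 3 * (\<Sum>i\<in>I. a i ^ 2) * ?s + 2 * (\<Sum>i\<in>I. a i ^ 3)"
  proof -
    have r: "(\<Sum>r\<in>I. if p \<noteq> q \<and> p \<noteq> r \<and> q \<noteq> r then a p * a q * a r else 0) =
      a p * a q * ?s - a p ^ 2 * a q - a p * a q ^ 2 -
      (if p = q then a p ^ 2 * ?s - 2 * a p ^ 3 else 0)"
      if "p \<in> I" "q \<in> I" for p q
    proof (cases "p = q")
      case False
      then have "(\<Sum>r\<in>I. if p \<noteq> q \<and> p \<noteq> r \<and> q \<noteq> r then a p * a q * a r else 0) =
        (\<Sum>r\<in>I. a p * a q * a r - (if p = r then a p * a q * a r else 0)
          - (if q = r then a p * a q * a r else 0))"
        by (intro sum.cong) auto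
      also have "\<dots> = a p * a q * ?s - a p ^ 2 * a q - a p * a q ^ 2"
        using assms that
        by (simp add: sum_subtractf sum_distrib_left power2_eq_square mult_ac)
      finally show ?thesis using False by simp
    qed (simp add: power2_eq_square power3_eq_cube algebra_simps)
    have q: "(\<Sum>q\<in>I. \<Sum>r\<in>I. if p \<noteq> q \<and> p \<noteq> r \<and> q \<noteq> r then a p * a q * a r else 0) =
      a p * ?s ^ 2 - 2 * (a p ^ 2 * ?s) - a p * (\<Sum>i\<in>I. a i ^ 2) + 2 * a p ^ 3"
      if "p \<in> I" for p
    proof -
      have "(\<Sum>q\<in>I. \<Sum>r\<in>I. if p \<noteq> q \<and> p \<noteq> r \<and> q \<noteq> r then a p * a q * a r else 0) =
        (\<Sum>q\<in>I. a p * a q * ?s - a p ^ 2 * a q - a p * a q ^ 2 -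
          (if p = q then a p ^ 2 * ?s - 2 * a p ^ 3 else 0))"
        using that by (intro sum.cong refl r)
      also have "\<dots> = a p * ?s * ?s - a p ^ 2 * ?s - a p * (\<Sum>i\<in>I. a i ^ 2)
          - (a p ^ 2 * ?s - 2 * a p ^ 3)"
        using assms that
        by (simp only: sum_subtractf sum_distrib_left[symmetric] sum_distrib_right[symmetric]
            sum.delta' if_True)
      finally show ?thesis by (simp add: power2_eq_square algebra_simps)
    qed
    have "(\<Sum>p\<in>I. \<Sum>q\<in>I. \<Sum>r\<in>I.
        if p \<noteq> q \<and> p \<noteq> r \<and> q \<noteq> r then a p * a q * a r else 0) =
      (\<Sum>p\<in>I. a p * ?s ^ 2 - 2 * (a p ^ 2 * ?s) - a p * (\<Sum>i\<in>I. a i ^ 2) + 2 * a p ^ 3)"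
      by (intro sum.cong refl q)
    also have "\<dots> =
      ?s * ?s ^ 2 - 2 * ((\<Sum>i\<in>I. a i ^ 2) * ?s) - ?s * (\<Sum>i\<in>I. a i ^ 2) + 2 * (\<Sum>i\<in>I. a i ^ 3)"
      by (simp only: sum.distrib sum_subtractf sum_distrib_left[symmetric]
          sum_distrib_right[symmetric])
    finally show ?thesis
      unfolding sum_distinct_triples[OF assms]
      by (simp add: power2_eq_square power3_eq_cube algebra_simps)
  qed
  show ?thesis unfolding pairs triples by (simp add: algebra_simps)
qed

text \<open>Empty factors \<open>A i\<close> are harmless, since division by zero yields zero.\<close>

lemma sum_PiE_prod_subset:
  fixes g :: "'i \<Rightarrow> 'a \<Rightarrow> 'b :: field_char_0"
  assumes "finite I" and "\<And>i. i \<in> I \<Longrightarrow> finite (A i)" and "J \<subseteq> I"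
  shows "(\<Sum>x \<in> Pi\<^sub>E I A. \<Prod>j\<in>J. g j (x j)) =
    of_nat (\<Prod>i\<in>I. card (A i)) * (\<Prod>j\<in>J. (\<Sum>v\<in>A j. g j v) / of_nat (card (A j)))"
proof -
  let ?h = "\<lambda>i v. if i \<in> J then g i v else 1"
  have restr: "(\<Prod>j\<in>J. f j) = (\<Prod>i\<in>I. if i \<in> J then f i else 1)" for f :: "'i \<Rightarrow> 'b"
    using assms by (simp add: prod.inter_restrict[symmetric] Int_absorb1)
  have "(\<Sum>x \<in> Pi\<^sub>E I A. \<Prod>j\<in>J. g j (x j)) = (\<Sum>x \<in> Pi\<^sub>E I A. \<Prod>i\<in>I. ?h i (x i))"
    by (simp add: restr)
  also have "\<dots> = (\<Prod>i\<in>I. \<Sum>v\<in>A i. ?h i v)"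
    using assms by (simp add: prod_sum_PiE)
  also have "\<dots> = (\<Prod>i\<in>I. of_nat (card (A i)) *
      (if i \<in> J then (\<Sum>v\<in>A i. g i v) / of_nat (card (A i)) else 1))"
    using assms by (intro prod.cong) auto
  finally show ?thesis by (simp add: prod.distrib restr)
qed

lemma (in pair_fin_digraph) sum_out_degree:
  "(\<Sum>v\<in>pverts G. out_degree (with_proj G) v) = card (parcs G)"
proof -
  have "card (parcs G) = card (\<Union>v\<in>pverts G. out_arcs (with_proj G) v)"
    by (rule arg_cong[of _ _ card]) (auto dest: in_arcsD1)
  also have "\<dots> = (\<Sum>v\<in>pverts G. out_degree (with_proj G) v)"
    unfolding out_degree_def
    by (intro card_UN_disjoint) (auto simp: out_arcs_def)
  finally show ?thesis by simp
qed

lemma (in pair_graph) card_parcs_uedges: "card (parcs G) = 2 * card (uedges G)"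
proof -
  let ?e = "\<lambda>(u, v). {u, v}"
  have U: "uedges G = ?e ` parcs G"
    by (auto simp: uedges_def image_iff)
  have fib: "card {a \<in> parcs G. ?e a = e} = 2" if "e \<in> ?e ` parcs G" for e
  proof -
    from that obtain u v where uv: "(u, v) \<in> parcs G" "e = {u, v}" by auto
    have vu: "(v, u) \<in> parcs G"
      using uv(1) pair_sym_arcs by (simp add: symmetric_def sym_def)
    have e: "?e a = e \<longleftrightarrow> a = (u, v) \<or> a = (v, u)" for a
      by (cases a) (simp add: uv(2) doubleton_eq_iff)
    have "{a \<in> parcs G. ?e a = e} = {(u, v), (v, u)}"
      unfolding e using uv(1) vu by blast
    moreover have "u \<noteq> v" using uv(1) no_loops' by blast
    ultimately show ?thesis by simp
  qed
  have "card (parcs G) = (\<Sum>e \<in> ?e ` parcs G. card {a \<in> parcs G. ?e a = e})"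
    using sum.image_gen[of "parcs G" "\<lambda>_. 1::nat" ?e] by simp
  also have "\<dots> = (\<Sum>e \<in> ?e ` parcs G. 2)"
    by (intro sum.cong refl fib)
  finally show ?thesis by (simp add: U)
qed

lemma out_degree_cartesian_product_family:
  assumes "finite I" and "\<And>i. i \<in> I \<Longrightarrow> pair_graph (G i)"
    and x: "x \<in> pverts (cartesian_product_family I G)"
  shows "out_degree (with_proj (cartesian_product_family I G)) x =
    (\<Sum>i\<in>I. out_degree (with_proj (G i)) (x i))"
proof -
  let ?P = "cartesian_product_family I G"
  let ?B = "\<lambda>i. (\<lambda>a. (x, x(i := snd a))) ` out_arcs (with_proj (G i)) (x i)"
  have xV: "x \<in> (\<Pi>\<^sub>E i\<in>I. pverts (G i))"
    using x by (simp add: cartesian_product_family_def)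
  have arc: "v \<in> pverts (G i)" "u \<noteq> v" if "i \<in> I" "(u, v) \<in> parcs (G i)" for i u v
  proof -
    interpret pair_graph "G i" using assms(2) that(1) .
    show "v \<in> pverts (G i)" "u \<noteq> v" using that(2) in_arcsD2 no_loops' by blast+
  qed
  have fin: "finite (out_arcs (with_proj (G i)) (x i))" if "i \<in> I" for i
  proof -
    interpret pair_graph "G i" using assms(2) that .
    show ?thesis by (simp add: out_arcs_def)
  qed
  have "out_arcs (with_proj ?P) x = (\<Union>i\<in>I. ?B i)"
  proof (intro equalityI subsetI)
    fix a assume "a \<in> out_arcs (with_proj ?P) x"
    then obtain y i where a: "a = (x, y)" and y: "y \<in> (\<Pi>\<^sub>E i\<in>I. pverts (G i))"
      and i: "i \<in> I" "{j \<in> I. x j \<noteq> y j} = {i}" "(x i, y i) \<in> parcs (G i)"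
      by (auto simp: out_arcs_def cartesian_product_family_def)
    have "y = x(i := y i)"
    proof
      fix j show "y j = (x(i := y i)) j"
        using xV y i(2) by (cases "j \<in> I") (auto simp: PiE_def extensional_def)
    qed
    with a i have "a \<in> ?B i"
      by (intro image_eqI[of _ _ "(x i, y i)"]) auto
    with i(1) show "a \<in> (\<Union>i\<in>I. ?B i)" by blast
  next
    fix a assume "a \<in> (\<Union>i\<in>I. ?B i)"
    then obtain i v where i: "i \<in> I" and v: "(x i, v) \<in> parcs (G i)" and a: "a = (x, x(i := v))"
      by auto
    have "{j \<in> I. x j \<noteq> (x(i := v)) j} = {i}"
      using i arc(2)[OF i v] by auto
    moreover have "x(i := v) \<in> (\<Pi>\<^sub>E i\<in>I. pverts (G i))"
      using xV i arc(1)[OF i v] by (auto simp: PiE_def extensional_def Pi_def)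
    ultimately show "a \<in> out_arcs (with_proj ?P) x"
      using i v a xV unfolding out_arcs_def cartesian_product_family_def by auto
  qed
  moreover have "?B i \<inter> ?B j = {}" if "i \<in> I" "j \<in> I" "i \<noteq> j" for i j
  proof -
    have "x(i := v) \<noteq> x(j := w)" if "(x i, v) \<in> parcs (G i)" for v w
      using arc(2)[OF \<open>i \<in> I\<close> that] \<open>i \<noteq> j\<close> by (metis fun_upd_other fun_upd_same)
    then show ?thesis by auto
  qed
  ultimately have "out_degree (with_proj ?P) x = (\<Sum>i\<in>I. card (?B i))"
    using assms(1) fin by (simp add: out_degree_def card_UN_disjoint)
  also have "\<dots> = (\<Sum>i\<in>I. out_degree (with_proj (G i)) (x i))"
    unfolding out_degree_def
    by (intro sum.cong refl card_image inj_onI) (auto dest: fun_upd_eqD)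
  finally show ?thesis .
qed

theorem theorem4:
  fixes k N :: nat
    and G :: "nat \<Rightarrow> 'a pair_pre_digraph"
    and n m :: "nat \<Rightarrow> nat"
  assumes "k \<ge> 1"
    and "\<And>i. i \<in> {1..k} \<Longrightarrow> pair_graph (G i)"
    and "\<And>i. i \<in> {1..k} \<Longrightarrow> Digraph_Component.connected (with_proj (G i))"
    and "\<And>i. i \<in> {1..k} \<Longrightarrow> n i = card (pverts (G i))"
    and "\<And>i. i \<in> {1..k} \<Longrightarrow> m i = card (uedges (G i))"
    and "N = (\<Prod>i=1..k. n i)"
  shows "real (forgotten_index (cartesian_product_family {1..k} G)) =
      real N * (\<Sum>i=1..k. real (forgotten_index (G i)) / real (n i))
    + 6 * real N * (\<Sum>(i, j) \<in> {(i, j). i \<in> {1..k} \<and> j \<in> {1..k} \<and> i \<noteq> j}.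
        real (first_zagreb (G i)) / real (n i) * (real (m j) / real (n j)))
    + 8 * real N * (\<Sum>(p, q, r) \<in> {(p, q, r). p \<in> {1..k} \<and> q \<in> {1..k} \<and> r \<in> {1..k} \<and>
          p \<noteq> q \<and> p \<noteq> r \<and> q \<noteq> r}.
        real (m p) / real (n p) * (real (m q) / real (n q)) * (real (m r) / real (n r)))"
proof -
  let ?I = "{1..k}"
  let ?V = "\<Pi>\<^sub>E i\<in>?I. pverts (G i)"
  let ?I2 = "{(i, j). i \<in> ?I \<and> j \<in> ?I \<and> i \<noteq> j}"
  let ?I3 = "{(p, q, r). p \<in> ?I \<and> q \<in> ?I \<and> r \<in> ?I \<and> p \<noteq> q \<and> p \<noteq> r \<and> q \<noteq> r}"
  define d where "d i v = real (out_degree (with_proj (G i)) v)" for i v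
  have fin: "finite (pverts (G i))" if "i \<in> ?I" for i
  proof -
    interpret pair_graph "G i" using assms(2) that .
    show ?thesis by simp
  qed
  have N: "N = (\<Prod>i\<in>?I. card (pverts (G i)))"
    using assms(4,6) by simp
  have handshake: "(\<Sum>v\<in>pverts (G i). d i v) = 2 * real (m i)" if "i \<in> ?I" for i
  proof -
    interpret pair_graph "G i" using assms(2) that .
    show ?thesis
      using sum_out_degree card_parcs_uedges assms(5)[OF that]
      by (simp add: d_def flip: of_nat_sum)
  qed
  have avg: "(\<Sum>x\<in>?V. \<Prod>j\<in>J. g j (x j)) =
      real N * (\<Prod>j\<in>J. (\<Sum>v\<in>pverts (G j). g j v) / real (n j))"
    if "J \<subseteq> ?I" for J and g :: "nat \<Rightarrow> 'a \<Rightarrow> real"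
  proof -
    have "(\<Prod>j\<in>J. (\<Sum>v\<in>pverts (G j). g j v) / real (card (pverts (G j)))) =
      (\<Prod>j\<in>J. (\<Sum>v\<in>pverts (G j). g j v) / real (n j))"
      using that assms(4) by (intro prod.cong) auto
    then show ?thesis
      using sum_PiE_prod_subset[of ?I "\<lambda>i. pverts (G i)" J g] fin that by (simp add: N)
  qed
  have avg1: "(\<Sum>x\<in>?V. d i (x i) ^ 3) = real N * (real (forgotten_index (G i)) / real (n i))"
    if "i \<in> ?I" for i
    using avg[of "{i}" "\<lambda>i v. d i v ^ 3"] that by (simp add: forgotten_index_def d_def)
  have avg2: "(\<Sum>x\<in>?V. d i (x i) ^ 2 * d j (x j)) =
      2 * real N * (real (first_zagreb (G i)) / real (n i) * (real (m j) / real (n j)))"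
    if "i \<in> ?I" "j \<in> ?I" "i \<noteq> j" for i j
    using avg[of "{i, j}" "\<lambda>l v. if l = i then d i v ^ 2 else d l v"] that handshake[of j]
    by (simp add: first_zagreb_def d_def)
  have avg3: "(\<Sum>x\<in>?V. d p (x p) * d q (x q) * d r (x r)) =
      8 * real N * (real (m p) / real (n p) * (real (m q) / real (n q)) * (real (m r) / real (n r)))"
    if "p \<in> ?I" "q \<in> ?I" "r \<in> ?I" "p \<noteq> q" "p \<noteq> r" "q \<noteq> r" for p q r
    using avg[of "{p, q, r}" d] that handshake[of p] handshake[of q] handshake[of r]
    by (simp add: mult.assoc)
  have "real (forgotten_index (cartesian_product_family ?I G)) = (\<Sum>x\<in>?V. (\<Sum>i\<in>?I. d i (x i)) ^ 3)"
  proof -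
    have "real (out_degree (with_proj (cartesian_product_family ?I G)) x) = (\<Sum>i\<in>?I. d i (x i))"
      if "x \<in> ?V" for x
      using out_degree_cartesian_product_family[of ?I G x] assms(2) that
      by (simp add: d_def cartesian_product_family_def)
    then show ?thesis
      by (simp add: forgotten_index_def cartesian_product_family_def)
  qed
  also have "\<dots> = (\<Sum>x\<in>?V. \<Sum>i\<in>?I. d i (x i) ^ 3)
      + 3 * (\<Sum>x\<in>?V. \<Sum>(i, j)\<in>?I2. d i (x i) ^ 2 * d j (x j))
      + (\<Sum>x\<in>?V. \<Sum>(p, q, r)\<in>?I3. d p (x p) * d q (x q) * d r (x r))"
    by (simp only: sum_power3_distinct[OF finite_atLeastAtMost] sum.distrib sum_distrib_left)
  also have "(\<Sum>x\<in>?V. \<Sum>i\<in>?I. d i (x i) ^ 3) =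
      real N * (\<Sum>i\<in>?I. real (forgotten_index (G i)) / real (n i))"
    unfolding sum_distrib_left by (subst sum.swap) (intro sum.cong refl avg1)
  also have "(\<Sum>x\<in>?V. \<Sum>(i, j)\<in>?I2. d i (x i) ^ 2 * d j (x j)) =
      2 * real N * (\<Sum>(i, j)\<in>?I2. real (first_zagreb (G i)) / real (n i) * (real (m j) / real (n j)))"
    unfolding sum_distrib_left
    by (subst sum.swap, intro sum.cong refl) (elim CollectE case_prodE conjE, simp only: case_prod_conv simp_thms avg2)
  also have "(\<Sum>x\<in>?V. \<Sum>(p, q, r)\<in>?I3. d p (x p) * d q (x q) * d r (x r)) =
      8 * real N * (\<Sum>(p, q, r)\<in>?I3.
        real (m p) / real (n p) * (real (m q) / real (n q)) * (real (m r) / real (n r)))"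
    unfolding sum_distrib_left
    by (subst sum.swap, intro sum.cong refl) (elim CollectE case_prodE conjE, simp only: case_prod_conv simp_thms avg3)
  finally show ?thesis by simp
qed

end
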